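(* Let $\mathcal{A}=\langle 1,S,\psi,N,\beta,2\rangle$ be a one-dimensional wireless network with path-loss exponent $\alpha=2$, noise $N\ge 0$, reception threshold $\beta\ge 1$, and $n\ge 2$ stations $S=\{s_1,\dots,s_n\}\subset\mathbb{R}$ with powers $\psi_1,\dots,\psi_n>0$. For each $i$, let $\mu_i(\mathcal{A})$ denote the number of cells (maximal connected components) of the reception zone $H_i(\mathcal{A})$. Then $$\sum_{i=1}^{n}\mu_i(\mathcal{A})\le 2n-1 .$$
   Context: A wireless network $\mathcal{A}=\langle d,S,\psi,N,\beta,\alpha\rangle$ consists of a dimension $d\ge 1$, a set $S=\{s_1,\dots,s_n\}$ of $n\ge 2$ stations (points of $\mathbb{R}^d$), powers $\psi_i>0$, background noise $N\ge 0$, a reception threshold $\beta\ge 1$ and a path-loss exponent $\alpha>0$. For $p\notin S$, $$\mathrm{SINR}(s_i,p)=\frac{\psi_i\,\|s_i-p\|^{-\alpha}}{\sum_{j\ne i}\psi_j\,\|s_j-p\|^{-\alpha}+N}.$$ The reception zone of $s_i$ is $H_i(\mathcal{A})=\{p\in\mathbb{R}^d\setminus S:\mathrm{SINR}(s_i,p)\ge\beta\}\cup\{s_i\}$. A cell of a zone is a maximal connected subset of it. *)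

theory Defs
  imports "HOL-Analysis.Analysis"
begin

text \<open>The dimension \<open>d\<close> is that of the ambient Euclidean space \<open>'a\<close>, so one-dimensional
  networks have type \<open>real wireless_network\<close>. Stations and powers are indexed by \<open>1, \<dots>, n\<close>;
  their values at other indices are irrelevant.\<close>

record 'a wireless_network =
  num_stations :: nat
  station :: "nat \<Rightarrow> 'a"
  power :: "nat \<Rightarrow> real"
  noise :: real
  threshold :: real
  path_loss :: real

definition valid_network :: "'a::euclidean_space wireless_network \<Rightarrow> bool" where
  "valid_network A \<longleftrightarrow>
     num_stations A \<ge> 2 \<and>
     inj_on (station A) {1..num_stations A} \<and>
     (\<forall>i\<in>{1..num_stations A}. power A i > 0) \<and>
     noise A \<ge> 0 \<and> threshold A \<ge> 1 \<and> path_loss A > 0"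

definition stations :: "'a wireless_network \<Rightarrow> 'a set" where
  "stations A = station A ` {1..num_stations A}"

text \<open>The value is meaningful only for \<open>p \<notin> stations A\<close>; there, all distances and (in a valid
  network) the denominator are positive.\<close>

definition SINR :: "'a::euclidean_space wireless_network \<Rightarrow> nat \<Rightarrow> 'a \<Rightarrow> real" where
  "SINR A i p =
     power A i * norm (station A i - p) powr (- path_loss A) /
     ((\<Sum>j\<in>{1..num_stations A} - {i}. power A j * norm (station A j - p) powr (- path_loss A))
        + noise A)"

definition reception_zone :: "'a::euclidean_space wireless_network \<Rightarrow> nat \<Rightarrow> 'a set" where
  "reception_zone A i = {p. p \<notin> stations A \<and> SINR A i p \<ge> threshold A} \<union> {station A i}"

definition cells :: "'a::euclidean_space wireless_network \<Rightarrow> nat \<Rightarrow> 'a set set" where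
  "cells A i = components (reception_zone A i)"

text \<open>Since \<open>card\<close> is \<open>0\<close> on infinite sets, a bound on this number says something about the
  cells only together with \<open>finite (cells A i)\<close>.\<close>

definition num_cells :: "'a::euclidean_space wireless_network \<Rightarrow> nat \<Rightarrow> nat" where
  "num_cells A i = card (cells A i)"

end

theory Submission
  imports Defs
begin

text \<open>In the coordinate \<open>1 / (p - s\<^sub>i)\<close> the interference-to-signal ratio of station \<open>i\<close> is a sum
  of inverse squares of affine functions, hence convex off the other stations. So
  two cells of \<open>i\<close> are always separated by another station. Two stations are
  compared by the sign of a quadratic, so their zones cannot alternate in the pattern \<open>i k i k\<close>.
  Say that \<open>i\<close> encloses \<open>k\<close> if \<open>s\<^sub>k\<close> lies between two points of the zone of \<open>i\<close>; this is an acyclic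
  relation. Sending each gap between consecutive cells of \<open>i\<close> to a station in it that is enclosed
  by no other station in it is injective over all gaps of all stations, and misses a station that
  nobody encloses. Hence there are at most \<open>n - 1\<close> gaps, that is, at most \<open>2 n - 1\<close> cells.\<close>

section \<open>Noncrossing families of sets on the line\<close>

text \<open>Separates the counting from the geometry: these properties of sites \<open>s i\<close>
  and zones \<open>Z i\<close> are all that the bound uses. Distinct zones may share points, as can
  happen for \<open>threshold A = 1\<close>, so the strict inequalities in
  \<open>noncrossing\<close> matter.\<close>

locale noncrossing_family =
  fixes I :: "'i set" and s :: "'i \<Rightarrow> real" and Z :: "'i \<Rightarrow> real set"
  assumes finite_I: "finite I"
    and site_in: "i \<in> I \<Longrightarrow> s i \<in> Z i"
    and site_notin: "i \<in> I \<Longrightarrow> j \<in> I \<Longrightarrow> i \<noteq> j \<Longrightarrow> s j \<notin> Z i"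
    and segment: "i \<in> I \<Longrightarrow> x \<in> Z i \<Longrightarrow> y \<in> Z i \<Longrightarrow> x < y \<Longrightarrow>
      (\<And>j. j \<in> I \<Longrightarrow> j \<noteq> i \<Longrightarrow> s j \<notin> {x..y}) \<Longrightarrow> {x..y} \<subseteq> Z i"
    and noncrossing: "i \<in> I \<Longrightarrow> k \<in> I \<Longrightarrow> i \<noteq> k \<Longrightarrow> w \<in> Z i \<Longrightarrow> x \<in> Z k \<Longrightarrow> y \<in> Z i \<Longrightarrow> z \<in> Z k \<Longrightarrow>
      w < x \<Longrightarrow> x < y \<Longrightarrow> \<not> y < z"
begin

section \<open>The enclosure order\<close>

definition encloses :: "'i \<Rightarrow> 'i \<Rightarrow> bool" where
  "encloses i k \<longleftrightarrow> i \<in> I \<and> k \<in> I \<and> i \<noteq> k \<and> (\<exists>x\<in>Z i. \<exists>y\<in>Z i. x < s k \<and> s k < y)"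

text \<open>A point of \<open>Z k\<close> left of \<open>x\<close> would form the pattern k i k i
  with \<open>x\<close>, \<open>s k\<close>, \<open>y\<close>; one right of \<open>y\<close> would
  form i k i k.\<close>

lemma between_subset:
  assumes "i \<in> I" "k \<in> I" "i \<noteq> k" "x \<in> Z i" "y \<in> Z i" "x < s k" "s k < y"
  shows "Z k \<subseteq> {x..y}"
proof
  fix z assume z: "z \<in> Z k"
  have "\<not> z < x"
    using noncrossing[of k i z x "s k" y] assms z site_in by auto
  moreover have "\<not> y < z"
    using noncrossing[of i k x "s k" y z] assms z site_in by auto
  ultimately show "z \<in> {x..y}" by auto
qed

text \<open>Mutual enclosure traps each zone between two points of the other, so both have the same
  extreme points. As zones may share points, this is no contradiction yet; either order of the two
  sites then yields an alternation.\<close>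

lemma encloses_asym:
  assumes "encloses i k" shows "\<not> encloses k i"
proof
  assume ki: "encloses k i"
  obtain x y where xy: "x \<in> Z i" "y \<in> Z i" "x < s k" "s k < y"
    using assms unfolding encloses_def by blast
  obtain u v where uv: "u \<in> Z k" "v \<in> Z k" "u < s i" "s i < v"
    using ki unfolding encloses_def by blast
  have ik: "i \<in> I" "k \<in> I" "i \<noteq> k" using assms unfolding encloses_def by auto
  have "Z k \<subseteq> {x..y}" "Z i \<subseteq> {u..v}"
    using between_subset ik xy uv by metis+
  then have eq: "x = u" "y = v" using xy uv by (meson atLeastAtMost_iff order_antisym subsetD)+
  have "s i \<noteq> s k" using site_in site_notin ik by metis
  then consider "s i < s k" | "s k < s i" by linarith
  then show False
  proof cases
    case 1
    then show False
      using noncrossing[of k i u "s i" "s k" y] ik xy uv site_in by auto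
  next
    case 2
    then show False
      using noncrossing[of i k x "s k" "s i" v] ik xy uv site_in by auto
  qed
qed

lemma encloses_trans:
  assumes "encloses i j" "encloses j k" shows "encloses i k"
proof -
  obtain x y where xy: "x \<in> Z i" "y \<in> Z i" "x < s j" "s j < y"
    using assms(1) unfolding encloses_def by blast
  obtain u v where uv: "u \<in> Z j" "v \<in> Z j" "u < s k" "s k < v"
    using assms(2) unfolding encloses_def by blast
  have "Z j \<subseteq> {x..y}"
    using between_subset xy assms unfolding encloses_def by metis
  then have "x < s k" "s k < y" using uv by fastforce+
  moreover have "i \<noteq> k" using assms encloses_asym by blast
  ultimately show ?thesis using xy assms unfolding encloses_def by blast
qed

lemma ex_unenclosed:
  assumes "K \<subseteq> I" "K \<noteq> {}"
  shows "\<exists>k\<in>K. \<forall>j\<in>K. \<not> encloses j k"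
proof -
  have "finite K" using assms finite_I finite_subset by blast
  \<comment> \<open>The order is reversed, so that a maximal element is one that nothing in
    \<open>K\<close> encloses.\<close>
  moreover have "asymp_on K (\<lambda>a b. encloses b a)" "transp_on K (\<lambda>a b. encloses b a)"
    using encloses_asym encloses_trans unfolding asymp_on_def transp_on_def by blast+
  ultimately obtain k where "k \<in> K" "\<forall>j\<in>K. j \<noteq> k \<longrightarrow> \<not> encloses j k"
    using Finite_Set.bex_max_element[of K "\<lambda>a b. encloses b a"] assms(2) by metis
  moreover have "\<not> encloses k k" using encloses_asym by metis
  ultimately show ?thesis by metis
qed

text \<open>Serves to exclude that \<open>k\<close> is outermost in gaps of two stations. Both
  intervals contain \<open>s k\<close> and hence overlap; if each site lay outside the other's
  interval, the two sites and one end of each interval would alternate.\<close>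

lemma common_outermost_site:
  assumes "i \<in> I" "j \<in> I" "k \<in> I" "i \<noteq> j" "i \<noteq> k" "j \<noteq> k"
    and x: "x \<in> Z i" "x' \<in> Z i" "x < s k" "s k < x'"
    and y: "y \<in> Z j" "y' \<in> Z j" "y < s k" "s k < y'"
  shows "x < s j \<and> s j < x' \<or> y < s i \<and> s i < y'"
proof (rule ccontr)
  assume "\<not> ?thesis"
  then have out: "s j \<le> x \<or> x' \<le> s j" "s i \<le> y \<or> y' \<le> s i" by auto
  have si: "s i \<in> Z i" "s j \<in> Z j" and ne: "s i \<notin> Z j" "s j \<notin> Z i"
    using site_in site_notin assms by auto
  have nn: "s j \<noteq> x" "s j \<noteq> x'" "s i \<noteq> y" "s i \<noteq> y'" "s i \<noteq> s j" using si ne x y by auto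
  have A: "\<not> (a < b \<and> b < c \<and> c < d)"
    if "a \<in> Z i" "b \<in> Z j" "c \<in> Z i" "d \<in> Z j" for a b c d
    using noncrossing that assms by metis
  have B: "\<not> (b < a \<and> a < d \<and> d < c)"
    if "a \<in> Z i" "b \<in> Z j" "c \<in> Z i" "d \<in> Z j" for a b c d
    using noncrossing that assms by metis
  have mid: "x < y'" "y < x'" using x y by linarith+
  have out_i: "s i < y \<or> y' < s i" and out_j: "s j < x \<or> x' < s j" using out nn by auto
  from out_j show False
  proof
    assume j: "s j < x"
    from out_i show False
    proof
      assume "s i < y"
      then show False
        using A[OF si x(1) y(2)] B[OF si x(2) y(1)] j mid nn(5) by (meson linorder_neqE)
    next
      assume "y' < s i"
      then show False using B[OF x(1) si(2) si(1) y(2)] j mid by blast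
    qed
  next
    assume j: "x' < s j"
    from out_i show False
    proof
      assume "s i < y"
      then show False using A[OF si(1) y(1) x(2) si(2)] j mid by blast
    next
      assume "y' < s i"
      then show False
        using A[OF x(1) y(2) si] B[OF x(2) y(1) si] j mid nn(5) by (meson linorder_neqE)
    qed
  qed
qed

section \<open>Ranks of components\<close>

text \<open>The rank tells between which consecutive foreign sites \<open>x\<close> lies, and so
  labels the cells of \<open>i\<close> from left to right.\<close>

definition rank :: "'i \<Rightarrow> real \<Rightarrow> nat" where
  "rank i x = card {j \<in> I - {i}. s j < x}"

lemma rank_less_iff:
  assumes "i \<in> I" "x \<in> Z i"
  shows "rank i x < rank i y \<longleftrightarrow> (\<exists>j\<in>I - {i}. x < s j \<and> s j < y)"
proof
  assume l: "rank i x < rank i y"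
  have "\<not> {j \<in> I - {i}. s j < y} \<subseteq> {j \<in> I - {i}. s j < x}"
    using l card_mono[of "{j \<in> I - {i}. s j < x}" "{j \<in> I - {i}. s j < y}"] finite_I
    unfolding rank_def by fastforce
  then obtain j where "j \<in> I - {i}" "s j < y" "x \<le> s j" by fastforce
  \<comment> \<open>The case \<open>x = s j\<close> is impossible because \<open>Z i\<close>
    contains no foreign site.\<close>
  then show "\<exists>j\<in>I - {i}. x < s j \<and> s j < y"
    using assms site_notin by (metis DiffD1 DiffD2 insertI1 order_le_less)
next
  assume "\<exists>j\<in>I - {i}. x < s j \<and> s j < y"
  then obtain j where j: "j \<in> I - {i}" "x < s j" "s j < y" by blast
  have "{j \<in> I - {i}. s j < x} \<subseteq> {j \<in> I - {i}. s j < y}" using j by auto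
  moreover have "j \<in> {j \<in> I - {i}. s j < y}" "j \<notin> {j \<in> I - {i}. s j < x}" using j by auto
  ultimately have "{j \<in> I - {i}. s j < x} \<subset> {j \<in> I - {i}. s j < y}" by blast
  then show "rank i x < rank i y"
    unfolding rank_def by (rule psubset_card_mono[rotated]) (simp add: finite_I)
qed

text \<open>Points of equal rank have no foreign site between them, so \<open>segment\<close> joins
  them inside \<open>Z i\<close>. Any representatives of the components will do.\<close>

lemma inj_on_component_rank:
  assumes "i \<in> I"
  shows "inj_on (\<lambda>C. rank i (SOME x. x \<in> C)) (components (Z i))"
proof (rule inj_onI)
  fix C D
  assume C: "C \<in> components (Z i)" and D: "D \<in> components (Z i)"
    and eq: "rank i (SOME x. x \<in> C) = rank i (SOME x. x \<in> D)"
  define x where "x = (SOME x. x \<in> C)"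
  define y where "y = (SOME x. x \<in> D)"
  have x: "x \<in> C" unfolding x_def using in_components_nonempty[OF C] by (simp add: some_in_eq)
  have y: "y \<in> D" unfolding y_def using in_components_nonempty[OF D] by (simp add: some_in_eq)
  have xz: "x \<in> Z i" "y \<in> Z i" using x y C D in_components_subset by blast+
  have seg: "{a..b} \<subseteq> Z i" if "a \<in> Z i" "b \<in> Z i" "a < b" "rank i a = rank i b" for a b
  proof (rule segment[OF assms that(1-3)])
    fix j assume "j \<in> I" "j \<noteq> i"
    then show "s j \<notin> {a..b}"
      using rank_less_iff[OF assms that(1), of b] that site_notin assms
      by (metis DiffI atLeastAtMost_iff empty_iff insert_iff less_irrefl order_le_less)
  qed
  have "\<exists>T. connected T \<and> T \<subseteq> Z i \<and> x \<in> T \<and> y \<in> T"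
  proof (cases x y rule: linorder_cases)
    case less
    then show ?thesis using seg[of x y] xz eq x_def y_def
      by (intro exI[of _ "{x..y}"]) (auto simp: connected_Icc)
  next
    case equal
    then show ?thesis using xz by (intro exI[of _ "{x}"]) auto
  next
    case greater
    then show ?thesis using seg[of y x] xz eq x_def y_def
      by (intro exI[of _ "{y..x}"]) (auto simp: connected_Icc)
  qed
  then obtain T where T: "connected T" "T \<subseteq> Z i" "x \<in> T" "y \<in> T" by blast
  have "T \<subseteq> C" "T \<subseteq> D"
    using components_maximal[OF C T(1,2)] components_maximal[OF D T(1,2)] T x y by blast+
  then show "C = D" using components_eq[OF C D] T by blast
qed

lemma finite_ranks: "finite (rank i ` Z i)"
  by (rule finite_subset[of _ "{..card I}"])
    (auto simp: rank_def finite_I intro!: card_mono)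

lemma component_ranks_subset:
  assumes "i \<in> I"
  shows "(\<lambda>C. rank i (SOME x. x \<in> C)) ` components (Z i) \<subseteq> rank i ` Z i"
  using in_components_nonempty in_components_subset by (fastforce simp: some_in_eq)

lemma finite_components: "i \<in> I \<Longrightarrow> finite (components (Z i))"
  using inj_on_component_rank component_ranks_subset finite_ranks inj_on_finite by metis

lemma card_components_le_ranks: "i \<in> I \<Longrightarrow> card (components (Z i)) \<le> card (rank i ` Z i)"
  using inj_on_component_rank component_ranks_subset finite_ranks card_inj_on_le by metis

section \<open>Gaps and their outermost sites\<close>

text \<open>A pair \<open>(i, r)\<close> of this set stands for the gap between the cell of \<open>i\<close> of rank \<open>r\<close> and
  the cell to its left.\<close>

definition gaps :: "('i \<times> nat) set" where
  "gaps = (SIGMA i:I. rank i ` Z i - {Min (rank i ` Z i)})"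

text \<open>Arbitrary points of two consecutive cells: the last conjunct makes the cell of
  \<open>x\<close> the nearest one to the left of the cell of \<open>y\<close>.\<close>

definition gap_bounds :: "'i \<Rightarrow> nat \<Rightarrow> real \<Rightarrow> real \<Rightarrow> bool" where
  "gap_bounds i r x y \<longleftrightarrow> x \<in> Z i \<and> y \<in> Z i \<and> rank i y = r \<and> rank i x < r \<and>
     (\<forall>z\<in>Z i. rank i z < r \<longrightarrow> rank i z \<le> rank i x)"

text \<open>Station \<open>i\<close> is left out of the competition: it may itself lie between
  \<open>x\<close> and \<open>y\<close>, and it encloses every foreign site there.\<close>

definition outermost_in_gap :: "'i \<Rightarrow> nat \<Rightarrow> 'i \<Rightarrow> bool" where
  "outermost_in_gap i r k \<longleftrightarrow> k \<in> I \<and> k \<noteq> i \<and> (\<exists>x y. gap_bounds i r x y \<and> x < s k \<and> s k < y \<and>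
     (\<forall>j\<in>I - {i}. x < s j \<longrightarrow> s j < y \<longrightarrow> \<not> encloses j k))"

lemma ex_gap_bounds:
  assumes "(i, r) \<in> gaps" shows "\<exists>x y. gap_bounds i r x y"
proof -
  let ?R = "rank i ` Z i" and ?L = "{t \<in> rank i ` Z i. t < r}"
  have r: "r \<in> ?R" "r \<noteq> Min ?R" using assms unfolding gaps_def by auto
  have fin: "finite ?R" by (rule finite_ranks)
  have "Min ?R \<in> ?R" using fin r(1) by (intro Min_in) auto
  moreover have "Min ?R \<le> r" using fin r(1) by (rule Min_le)
  \<comment> \<open>Leaving the minimal rank out of \<open>gaps\<close> guarantees a cell further
    left, so that \<open>Max ?L\<close> is taken over a nonempty set.\<close>
  ultimately have "Min ?R \<in> ?L" using r(2) by auto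
  then have "Max ?L \<in> ?L" using fin by (intro Max_in) auto
  then obtain x where x: "x \<in> Z i" "rank i x = Max ?L" "rank i x < r" by auto
  obtain y where y: "y \<in> Z i" "rank i y = r" using r(1) by auto
  have "rank i z \<le> rank i x" if "z \<in> Z i" "rank i z < r" for z
    unfolding x(2) using that fin by (intro Max_ge) auto
  then show ?thesis using x y unfolding gap_bounds_def by blast
qed

lemma ex_outermost_in_gap:
  assumes "(i, r) \<in> gaps" shows "\<exists>k. outermost_in_gap i r k"
proof -
  obtain x y where xy: "gap_bounds i r x y" using ex_gap_bounds[OF assms] by blast
  have i: "i \<in> I" using assms unfolding gaps_def by auto
  let ?K = "{k \<in> I - {i}. x < s k \<and> s k < y}"
  have "?K \<noteq> {}" using rank_less_iff[of i x y] xy i unfolding gap_bounds_def by auto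
  then obtain k where "k \<in> ?K" "\<forall>j\<in>?K. \<not> encloses j k"
    using ex_unenclosed[of ?K] by auto
  then show ?thesis using xy unfolding outermost_in_gap_def by blast
qed

lemma outermost_encloses:
  assumes "(i, r) \<in> gaps" "outermost_in_gap i r k" shows "encloses i k"
  using assms unfolding outermost_in_gap_def gap_bounds_def encloses_def gaps_def by blast

text \<open>If \<open>q < r\<close>, the site \<open>s k\<close> separates a point \<open>x\<close>
  of the last cell before rank \<open>r\<close> from a point of rank \<open>q\<close> to its right.
  So \<open>q\<close> exceeds the rank of \<open>x\<close>, which was maximal below
  \<open>r\<close>.\<close>

lemma outermost_rank_le:
  assumes "i \<in> I" "outermost_in_gap i r k" "outermost_in_gap i q k"
  shows "r \<le> q"
proof (rule ccontr)
  assume "\<not> r \<le> q"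
  then have qr: "q < r" by simp
  obtain x where x: "x \<in> Z i" "x < s k" "\<forall>z\<in>Z i. rank i z < r \<longrightarrow> rank i z \<le> rank i x"
    using assms(2) unfolding outermost_in_gap_def gap_bounds_def by blast
  obtain y where y: "y \<in> Z i" "s k < y" "rank i y = q"
    using assms(3) unfolding outermost_in_gap_def gap_bounds_def by blast
  have "rank i x < rank i y"
    using rank_less_iff[OF assms(1) x(1), of y] x y assms(2) unfolding outermost_in_gap_def by blast
  then show False using x y qr by force
qed

text \<open>For \<open>i = j\<close>, \<open>outermost_rank_le\<close> applies in both directions.
  For \<open>i \<noteq> j\<close>, one of the two sites lies between the gap bounds of the other
  station and encloses \<open>k\<close>, against the choice of \<open>k\<close> as
  outermost.\<close>

lemma outermost_inj:
  assumes g: "(i, r) \<in> gaps" "(j, q) \<in> gaps" "outermost_in_gap i r k" "outermost_in_gap j q k"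
  shows "(i, r) = (j, q)"
proof (cases "i = j")
  case True
  have "i \<in> I" using g unfolding gaps_def by auto
  then show ?thesis using outermost_rank_le g True by (metis order_antisym)
next
  case False
  have e: "encloses i k" "encloses j k" using g outermost_encloses by blast+
  obtain x x' where x: "x \<in> Z i" "x' \<in> Z i" "x < s k" "s k < x'"
    "\<forall>l\<in>I - {i}. x < s l \<longrightarrow> s l < x' \<longrightarrow> \<not> encloses l k"
    using g(3) unfolding outermost_in_gap_def gap_bounds_def by blast
  obtain y y' where y: "y \<in> Z j" "y' \<in> Z j" "y < s k" "s k < y'"
    "\<forall>l\<in>I - {j}. y < s l \<longrightarrow> s l < y' \<longrightarrow> \<not> encloses l k"
    using g(4) unfolding outermost_in_gap_def gap_bounds_def by blast
  have "x < s j \<and> s j < x' \<or> y < s i \<and> s i < y'"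
    using common_outermost_site[OF _ _ _ False _ _ x(1-4) y(1-4)] e unfolding encloses_def by blast
  then show ?thesis using x(5) y(5) e False unfolding encloses_def by blast
qed

lemma card_gaps_less:
  assumes "I \<noteq> {}" shows "card gaps < card I"
proof -
  let ?f = "\<lambda>(i, r). SOME k. outermost_in_gap i r k"
  have f: "outermost_in_gap i r (?f (i, r))" if "(i, r) \<in> gaps" for i r
    using ex_outermost_in_gap[OF that] by (simp add: someI_ex)
  obtain m where m: "m \<in> I" "\<forall>j\<in>I. \<not> encloses j m"
    using ex_unenclosed[of I] assms by auto
  have "inj_on ?f gaps"
  proof (rule inj_onI, safe)
    fix i r j q
    assume g: "(i, r) \<in> gaps" "(j, q) \<in> gaps"
      and eq: "(SOME k. outermost_in_gap i r k) = (SOME k. outermost_in_gap j q k)"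
    have "(i, r) = (j, q)" using outermost_inj[OF g] f[OF g(1)] f[OF g(2)] eq by auto
    then show "i = j" "r = q" by auto
  qed
  moreover have "?f ` gaps \<subseteq> I - {m}"
  proof (rule image_subsetI)
    fix p assume p: "p \<in> gaps"
    obtain i r where ir: "p = (i, r)" by fastforce
    have "encloses i (?f p)" using f[of i r] outermost_encloses p ir by metis
    then show "?f p \<in> I - {m}" using m unfolding encloses_def by blast
  qed
  ultimately have "card gaps \<le> card (I - {m})"
    using finite_I card_inj_on_le by (metis finite_Diff)
  then show ?thesis using m finite_I by (metis card_Diff1_less le_less_trans)
qed

theorem sum_card_components_le:
  assumes "I \<noteq> {}"
  shows "(\<Sum>i\<in>I. card (components (Z i))) \<le> 2 * card I - 1"
proof -
  \<comment> \<open>The leftmost cell has no gap to its left, which accounts for the extra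
    one.\<close>
  have "card (components (Z i)) \<le> card (rank i ` Z i - {Min (rank i ` Z i)}) + 1" if "i \<in> I" for i
  proof -
    have "rank i ` Z i \<noteq> {}" using site_in[OF that] by auto
    then have "card (rank i ` Z i - {Min (rank i ` Z i)}) = card (rank i ` Z i) - 1"
      using finite_ranks[of i] by (simp add: card_Diff_singleton)
    then show ?thesis using card_components_le_ranks[OF that] by linarith
  qed
  then have "(\<Sum>i\<in>I. card (components (Z i)))
      \<le> (\<Sum>i\<in>I. card (rank i ` Z i - {Min (rank i ` Z i)}) + 1)"
    by (rule sum_mono)
  also have "\<dots> = card gaps + card I"
    unfolding gaps_def sum.distrib using finite_I finite_ranks by simp
  finally show ?thesis using card_gaps_less[OF assms] by linarith
qed

end

section \<open>Interference relative to a signal\<close>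

text \<open>Convexity of the inverse square on each half-line, from that of \<open>inverse\<close>
  and of the square; \<open>0 < a * b\<close> covers both half-lines.\<close>

lemma inverse_square_convex_comb:
  fixes a b l m :: real
  assumes ab: "0 < a * b" and l: "0 \<le> l" "0 \<le> m" "l + m = 1"
  shows "(1 / (l * a + m * b))\<^sup>2 \<le> l * (1 / a)\<^sup>2 + m * (1 / b)\<^sup>2"
proof -
  have pos: "(1 / (l * a + m * b))\<^sup>2 \<le> l * (1 / a)\<^sup>2 + m * (1 / b)\<^sup>2" if "0 < a" "0 < b" for a b :: real
  proof -
    have c: "convex_on {0<..} (inverse :: real \<Rightarrow> real)" by (rule convex_on_inverse) auto
    have l': "l = 1 - m" "m \<le> 1" using l by linarith+
    have d: "0 < l * a + m * b"
    proof (cases "l = 0")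
      case False
      then have "0 < l * a" using l that by simp
      then show ?thesis using l that by (simp add: add_pos_nonneg)
    qed (use l that in simp)
    have "inverse (l * a + m * b) \<le> l * inverse a + m * inverse b"
      using convex_onD[OF c l(2) l'(2), of a b] that l'(1) by simp
    then have "(inverse (l * a + m * b))\<^sup>2 \<le> (l * inverse a + m * inverse b)\<^sup>2"
      using d by (intro power_mono) auto
    also have "\<dots> \<le> l * (inverse a)\<^sup>2 + m * (inverse b)\<^sup>2"
    proof -
      have "l * u\<^sup>2 + m * v\<^sup>2 - (l * u + m * v)\<^sup>2 = l * m * (u - v)\<^sup>2" for u v
        unfolding l'(1) by algebra
      moreover have "0 \<le> l * m * (inverse a - inverse b)\<^sup>2" using l by simp
      ultimately show ?thesis by (metis diff_ge_0_iff_ge)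
    qed
    finally show ?thesis by (simp add: inverse_eq_divide)
  qed
  consider "0 < a" "0 < b" | "0 < -a" "0 < -b" using ab by (auto simp: zero_less_mult_iff)
  then show ?thesis
  proof cases
    case 2
    have "l * - a + m * - b = - (l * a + m * b)" by simp
    then show ?thesis using pos[OF 2] by (simp only: power_divide power2_minus)
  qed (use pos in auto)
qed

text \<open>The three secant slopes are nonpositive, nonnegative, nonpositive, and successive ones
  differ by \<open>a * (y - w)\<close> and \<open>a * (z - x)\<close>; hence \<open>a = 0\<close>.
  As the signs are weak, the zero polynomial cannot be excluded.\<close>

lemma nonneg_nonpos_alternation_quadratic:
  fixes a b c :: real
  assumes "w < x" "x < y" "y < z"
    and "0 \<le> a * w\<^sup>2 + b * w + c" "a * x\<^sup>2 + b * x + c \<le> 0"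
    and "0 \<le> a * y\<^sup>2 + b * y + c" "a * z\<^sup>2 + b * z + c \<le> 0"
  shows "a = 0 \<and> b = 0 \<and> c = 0"
proof -
  have slope: "(a * v\<^sup>2 + b * v + c) - (a * u\<^sup>2 + b * u + c) = (v - u) * (a * (u + v) + b)" for u v
    by algebra
  have 1: "a * (w + x) + b \<le> 0"
    using slope[of x w] assms by (smt (verit) mult_pos_pos)
  have 2: "0 \<le> a * (x + y) + b"
    using slope[of y x] assms by (smt (verit) mult_pos_neg)
  have 3: "a * (y + z) + b \<le> 0"
    using slope[of z y] assms by (smt (verit) mult_pos_pos)
  have "0 \<le> a * (y - w)" "a * (z - x) \<le> 0" using 1 2 3 by (auto simp: algebra_simps)
  then have "a = 0" using assms by (auto simp: zero_le_mult_iff mult_le_0_iff)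
  then show ?thesis using 1 2 assms by auto
qed

section \<open>The interference-to-signal ratio\<close>

text \<open>Interference plus noise over the signal at unit power, with the squared distance
  multiplied in so that the value at station \<open>i\<close> is 0. At another station division by
  zero drops a term, so such points must be excluded separately.\<close>

definition interference_ratio :: "real wireless_network \<Rightarrow> nat \<Rightarrow> real \<Rightarrow> real" where
  "interference_ratio A i p =
     (\<Sum>j\<in>{1..num_stations A} - {i}. power A j * ((p - station A i) / (p - station A j))\<^sup>2)
       + noise A * (p - station A i)\<^sup>2"

lemma station_neq:
  assumes "valid_network A" "i \<in> {1..num_stations A}" "j \<in> {1..num_stations A}" "i \<noteq> j"
  shows "station A i \<noteq> station A j"
  using assms unfolding valid_network_def by (metis inj_onD)

lemma reception_zone_iff:
  fixes A :: "real wireless_network"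
  assumes A: "valid_network A" "path_loss A = 2" and i: "i \<in> {1..num_stations A}"
  shows "p \<in> reception_zone A i \<longleftrightarrow>
    (\<forall>j\<in>{1..num_stations A} - {i}. p \<noteq> station A j) \<and>
    threshold A * interference_ratio A i p \<le> power A i"
proof (cases "p = station A i")
  case True
  have "interference_ratio A i p = 0" unfolding True interference_ratio_def by simp
  moreover have "0 \<le> power A i" using A(1) i by (simp add: valid_network_def less_imp_le)
  moreover have "p \<in> reception_zone A i" unfolding True reception_zone_def by simp
  ultimately show ?thesis using station_neq[OF A(1) i] True by auto
next
  case False
  let ?I = "{1..num_stations A}"
  show ?thesis
  proof (cases "p \<in> stations A")
    case True
    then show ?thesis using False by (auto simp: reception_zone_def stations_def)
  next
    case out: False
    have ne: "station A j \<noteq> p" if "j \<in> ?I" for j using out that by (auto simp: stations_def)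
    have powr: "\<bar>x - p\<bar> powr (- path_loss A) = 1 / (x - p)\<^sup>2" if "x \<noteq> p" for x
      using that A(2) by (simp add: powr_minus_divide powr_numeral)
    define D where "D = (\<Sum>j\<in>?I - {i}. power A j / (station A j - p)\<^sup>2) + noise A"
    have sinr: "SINR A i p = power A i / (station A i - p)\<^sup>2 / D"
      unfolding SINR_def D_def using ne i by (simp add: powr)
    have pos: "power A j > 0" if "j \<in> ?I" for j using A that by (simp add: valid_network_def)
    \<comment> \<open>As there are at least two stations, some interferer makes \<open>D\<close>
      positive even without noise.\<close>
    have "\<exists>j. j \<in> ?I - {i}"
      using A i by (intro exI[of _ "if i = 1 then 2 else 1"]) (auto simp: valid_network_def)
    then have "?I - {i} \<noteq> {}" by blast
    then have D: "D > 0"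
      unfolding D_def using A pos ne
      by (intro add_pos_nonneg sum_pos) (auto simp: valid_network_def)
    have sq: "(station A i - p)\<^sup>2 > 0" using False by simp
    have "interference_ratio A i p = D * (station A i - p)\<^sup>2"
      unfolding interference_ratio_def D_def
      by (simp add: power_divide sum_distrib_right distrib_right power2_commute)
    then have "threshold A \<le> SINR A i p \<longleftrightarrow> threshold A * interference_ratio A i p \<le> power A i"
      using D sq unfolding sinr by (simp add: field_simps)
    moreover have "\<forall>j\<in>?I - {i}. p \<noteq> station A j" using ne by blast
    moreover have "p \<in> reception_zone A i \<longleftrightarrow> threshold A \<le> SINR A i p"
      using out False by (simp add: reception_zone_def)
    ultimately show ?thesis by blast
  qed
qed

text \<open>Moving from \<open>y\<close> to \<open>u\<close> scales the distance to station
  \<open>i\<close> by exactly \<open>t\<close>. The distance to station \<open>j\<close> stays at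
  least \<open>t\<close> times the old one, since \<open>y\<close> and station \<open>i\<close> lie
  on the same side of it.\<close>

lemma interference_ratio_mono_to_station:
  assumes A: "valid_network A" and t: "0 \<le> t" "t \<le> 1"
    and u: "u = station A i + t * (y - station A i)"
    and sep: "\<And>j. j \<in> {1..num_stations A} - {i} \<Longrightarrow>
      0 < (station A i - station A j) * (y - station A j)"
  shows "interference_ratio A i u \<le> interference_ratio A i y"
proof -
  have dist: "(u - station A i)\<^sup>2 \<le> (y - station A i)\<^sup>2"
  proof -
    have "t\<^sup>2 \<le> 1" using t by (simp add: power_le_one)
    then show ?thesis unfolding u by (simp add: power_mult_distrib mult_left_le_one_le)
  qed
  have ratio: "((u - station A i) / (u - station A j))\<^sup>2 \<le> ((y - station A i) / (y - station A j))\<^sup>2"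
    if j: "j \<in> {1..num_stations A} - {i}" for j
  proof -
    define a where "a = station A i - station A j"
    define b where "b = y - station A j"
    have ab: "0 < a * b" using sep[OF j] by (simp add: a_def b_def)
    have ua: "u - station A j = (1 - t) * a + t * b" unfolding u a_def b_def by (simp add: algebra_simps)
    have ge: "(t * b)\<^sup>2 \<le> (u - station A j)\<^sup>2"
    proof -
      have "0 \<le> (1 - t)\<^sup>2 * a\<^sup>2 + 2 * ((1 - t) * t) * (a * b)"
        using t ab by (intro add_nonneg_nonneg mult_nonneg_nonneg[of _ "a * b"]) auto
      moreover have "(u - station A j)\<^sup>2 = (t * b)\<^sup>2 + ((1 - t)\<^sup>2 * a\<^sup>2 + 2 * ((1 - t) * t) * (a * b))"
        unfolding ua by algebra
      ultimately show ?thesis by linarith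
    qed
    show ?thesis
    proof (cases "t = 0")
      case True
      then show ?thesis by (simp add: u)
    next
      case False
      have b: "b \<noteq> 0" using ab by auto
      have "((u - station A i) / (u - station A j))\<^sup>2
          = (t * (y - station A i))\<^sup>2 / (u - station A j)\<^sup>2"
        by (simp add: u power_divide)
      also have "\<dots> \<le> (t * (y - station A i))\<^sup>2 / (t * b)\<^sup>2"
        using ge b False by (intro divide_left_mono mult_pos_pos) (auto intro: less_le_trans[OF _ ge])
      also have "\<dots> = ((y - station A i) / (y - station A j))\<^sup>2"
        using False by (simp add: b_def power_divide power_mult_distrib)
      finally show ?thesis .
    qed
  qed
  show ?thesis
    unfolding interference_ratio_def using A dist ratio
    by (intro add_mono sum_mono mult_left_mono) (auto simp: valid_network_def less_imp_le)
qed

text \<open>With \<open>v = 1 / (p - ?s)\<close>, the quotient \<open>(p - r) / (p - ?s)\<close>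
  equals \<open>1 + (?s - r) * v\<close>, which is affine in \<open>v\<close> and keeps its sign on
  the interval. Each summand is its inverse square; the noise term is that of \<open>v\<close>
  itself.\<close>

lemma interference_ratio_between:
  assumes A: "valid_network A" and xy: "x < y" "u \<in> {x..y}"
    and out: "station A i \<notin> {x..y}"
    and sep: "\<And>j. j \<in> {1..num_stations A} - {i} \<Longrightarrow> station A j \<notin> {x..y}"
    and le: "interference_ratio A i x \<le> c" "interference_ratio A i y \<le> c"
  shows "interference_ratio A i u \<le> c"
proof -
  let ?s = "station A i"
  define D where "D = (y - x) * (u - ?s)"
  define l where "l = (y - u) * (x - ?s) / D"
  define m where "m = (u - x) * (y - ?s) / D"
  have nz: "x - ?s \<noteq> 0" "y - ?s \<noteq> 0" "u - ?s \<noteq> 0" "D \<noteq> 0" using xy out by (auto simp: D_def)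
  have l0: "0 \<le> l" "0 \<le> m"
    unfolding l_def m_def D_def using xy out
    by (auto simp: zero_le_divide_iff zero_le_mult_iff mult_le_0_iff)
  have lm: "l + m = 1"
  proof -
    have "(y - u) * (x - ?s) + (u - x) * (y - ?s) = D" unfolding D_def by algebra
    then show ?thesis unfolding l_def m_def using nz by (simp add: add_divide_distrib[symmetric])
  qed
  text \<open>The coordinate \<open>1 / (p - s\<^sub>i)\<close> of \<open>u\<close> is the combination with weights \<open>l\<close> and \<open>m\<close> of those of
    \<open>x\<close> and \<open>y\<close>.\<close>
  have comb: "l * (v / (x - ?s)) + m * (w / (y - ?s)) = ((y - u) * v + (u - x) * w) / D" for v w
    unfolding l_def m_def using nz by (simp add: add_divide_distrib)
  have ratio: "((u - ?s) / (u - r))\<^sup>2 \<le> l * ((x - ?s) / (x - r))\<^sup>2 + m * ((y - ?s) / (y - r))\<^sup>2"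
    if r: "r \<notin> {x..y}" for r
  proof -
    have "0 < (x - r) / (x - ?s) * ((y - r) / (y - ?s))"
      using r out xy by (auto simp: zero_less_mult_iff zero_less_divide_iff divide_less_0_iff)
    from inverse_square_convex_comb[OF this l0 lm]
    have "(1 / (l * ((x - r) / (x - ?s)) + m * ((y - r) / (y - ?s))))\<^sup>2
      \<le> l * ((x - ?s) / (x - r))\<^sup>2 + m * ((y - ?s) / (y - r))\<^sup>2" by simp
    moreover have "l * ((x - r) / (x - ?s)) + m * ((y - r) / (y - ?s)) = (u - r) / (u - ?s)"
    proof -
      have "(y - u) * (x - r) + (u - x) * (y - r) = (y - x) * (u - r)" by algebra
      then show ?thesis unfolding comb D_def using xy by simp
    qed
    ultimately show ?thesis by simp
  qed
  have noise: "(u - ?s)\<^sup>2 \<le> l * (x - ?s)\<^sup>2 + m * (y - ?s)\<^sup>2"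
  proof -
    have "0 < 1 / (x - ?s) * (1 / (y - ?s))"
      using out xy by (auto simp: zero_less_mult_iff)
    from inverse_square_convex_comb[OF this l0 lm]
    have "(1 / (l * (1 / (x - ?s)) + m * (1 / (y - ?s))))\<^sup>2 \<le> l * (x - ?s)\<^sup>2 + m * (y - ?s)\<^sup>2" by simp
    moreover have "l * (1 / (x - ?s)) + m * (1 / (y - ?s)) = 1 / (u - ?s)"
      unfolding comb D_def using xy by simp
    ultimately show ?thesis by simp
  qed
  have "interference_ratio A i u \<le>
    (\<Sum>j\<in>{1..num_stations A} - {i}. power A j *
      (l * ((x - ?s) / (x - station A j))\<^sup>2 + m * ((y - ?s) / (y - station A j))\<^sup>2))
     + noise A * (l * (x - ?s)\<^sup>2 + m * (y - ?s)\<^sup>2)"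
    unfolding interference_ratio_def using A noise ratio sep
    by (intro add_mono sum_mono mult_left_mono) (auto simp: valid_network_def less_imp_le)
  also have "\<dots> = l * interference_ratio A i x + m * interference_ratio A i y"
    unfolding interference_ratio_def
    by (simp add: sum.distrib sum_distrib_left algebra_simps)
  also have "\<dots> \<le> c"
    using convex_bound_le[OF le l0 lm] .
  finally show ?thesis .
qed

section \<open>Reception zones as a noncrossing family\<close>

text \<open>If station \<open>i\<close> is outside the interval, convexity in the inverse coordinate
  applies. That coordinate is singular at the station, so otherwise each point is compared with the
  end on its own side.\<close>

lemma reception_zone_segment:
  fixes A :: "real wireless_network"
  assumes A: "valid_network A" "path_loss A = 2" and i: "i \<in> {1..num_stations A}"
    and x: "x \<in> reception_zone A i" and y: "y \<in> reception_zone A i" and xy: "x < y"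
    and sep: "\<And>j. j \<in> {1..num_stations A} \<Longrightarrow> j \<noteq> i \<Longrightarrow> station A j \<notin> {x..y}"
  shows "{x..y} \<subseteq> reception_zone A i"
proof
  let ?s = "station A i" and ?F = "interference_ratio A i"
  fix u assume u: "u \<in> {x..y}"
  have beta: "threshold A > 0" using A by (simp add: valid_network_def)
  have iff: "threshold A * ?F p \<le> power A i \<longleftrightarrow> ?F p \<le> power A i / threshold A" for p
    using beta by (simp add: field_simps)
  have le: "?F x \<le> power A i / threshold A" "?F y \<le> power A i / threshold A"
    using x y reception_zone_iff[OF A i] iff by auto
  \<comment> \<open>Here \<open>z\<close> will be the end on the same side of the station as
    \<open>u\<close>; the quotient is the parameter \<open>t\<close> of the motion.\<close>
  have toward: "?F u \<le> ?F z"
    if z: "z \<in> {x..y}" "?s \<in> {x..y}" "z \<noteq> ?s" "0 \<le> (u - ?s) / (z - ?s)" "(u - ?s) / (z - ?s) \<le> 1" for z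
  proof (rule interference_ratio_mono_to_station[OF A(1) z(4,5)])
    show "u = ?s + (u - ?s) / (z - ?s) * (z - ?s)" using z(3) by simp
    fix j assume "j \<in> {1..num_stations A} - {i}"
    then have "station A j \<notin> {x..y}" using sep by auto
    then show "0 < (?s - station A j) * (z - station A j)"
      using z by (auto simp: zero_less_mult_iff)
  qed
  have "?F u \<le> power A i / threshold A"
  proof (cases "?s \<in> {x..y}")
    case False
    then show ?thesis using interference_ratio_between[OF A(1) xy u False _ le] sep by auto
  next
    case s: True
    consider "u = ?s" | "u < ?s" | "?s < u" by linarith
    then show ?thesis
    proof cases
      case 1
      have "?F u = 0" unfolding 1 interference_ratio_def by simp
      moreover have "0 \<le> power A i / threshold A"
        using A i beta by (simp add: valid_network_def less_imp_le)
      ultimately show ?thesis by simp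
    next
      case 2
      then have "?F u \<le> ?F x"
        using s u xy by (intro toward) (auto simp: zero_le_divide_iff divide_le_eq)
      then show ?thesis using le by simp
    next
      case 3
      then have "?F u \<le> ?F y"
        using s u xy by (intro toward) (auto simp: zero_le_divide_iff divide_le_eq)
      then show ?thesis using le by simp
    qed
  qed
  then show "u \<in> reception_zone A i"
    using reception_zone_iff[OF A i, of u] iff sep u by auto
qed

text \<open>Only the term of \<open>k\<close> is kept from interference and noise, and the threshold
  is weakened to 1.\<close>

lemma reception_zone_dominates:
  fixes A :: "real wireless_network"
  assumes A: "valid_network A" "path_loss A = 2" and i: "i \<in> {1..num_stations A}"
    and k: "k \<in> {1..num_stations A}" "i \<noteq> k" and p: "p \<in> reception_zone A i"
  shows "power A k * (p - station A i)\<^sup>2 \<le> power A i * (p - station A k)\<^sup>2"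
proof -
  let ?g = "\<lambda>j. power A j * ((p - station A i) / (p - station A j))\<^sup>2"
  have p': "p \<noteq> station A k" "threshold A * interference_ratio A i p \<le> power A i"
    using p reception_zone_iff[OF A i] k by auto
  have nn: "0 \<le> ?g j" if "j \<in> {1..num_stations A}" for j
    using A that by (simp add: valid_network_def less_imp_le)
  have "?g k \<le> (\<Sum>j\<in>{1..num_stations A} - {i}. ?g j)"
    by (rule member_le_sum) (use k nn in auto)
  also have "\<dots> \<le> interference_ratio A i p"
    unfolding interference_ratio_def using A by (simp add: valid_network_def)
  finally have g: "?g k \<le> interference_ratio A i p" .
  then have "0 \<le> interference_ratio A i p" using nn[OF k(1)] by linarith
  then have "interference_ratio A i p \<le> threshold A * interference_ratio A i p"
    using A by (simp add: valid_network_def mult_le_cancel_right1)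
  then have "?g k \<le> power A i" using g p'(2) by linarith
  then show ?thesis using p'(1) by (simp add: power_divide field_simps)
qed

text \<open>The difference of the two sides in \<open>reception_zone_dominates\<close> is a
  polynomial of degree at most 2 in \<open>p\<close>, nonnegative on the zone of \<open>i\<close>
  and nonpositive on that of \<open>k\<close>. An alternation forces it to vanish.\<close>

lemma reception_zones_noncrossing:
  fixes A :: "real wireless_network"
  assumes A: "valid_network A" "path_loss A = 2" and i: "i \<in> {1..num_stations A}"
    and k: "k \<in> {1..num_stations A}" "i \<noteq> k"
    and z: "w \<in> reception_zone A i" "x \<in> reception_zone A k"
      "y \<in> reception_zone A i" "z \<in> reception_zone A k"
    and lt: "w < x" "x < y"
  shows "\<not> y < z"
proof
  assume yz: "y < z"
  define a where "a = power A i - power A k"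
  define b where "b = 2 * (power A k * station A i - power A i * station A k)"
  define c where "c = power A i * (station A k)\<^sup>2 - power A k * (station A i)\<^sup>2"
  have q: "a * p\<^sup>2 + b * p + c = power A i * (p - station A k)\<^sup>2 - power A k * (p - station A i)\<^sup>2" for p
    unfolding a_def b_def c_def by algebra
  have "a = 0 \<and> b = 0 \<and> c = 0"
    using reception_zone_dominates[OF A i k] reception_zone_dominates[OF A k(1) i k(2)[symmetric]] z
    by (intro nonneg_nonpos_alternation_quadratic[OF lt yz]) (auto simp: q)
  \<comment> \<open>At station \<open>i\<close> the quadratic reduces to its power times the squared
    distance of the two stations, which cannot be 0.\<close>
  then have "power A i * (station A i - station A k)\<^sup>2 = 0" using q[of "station A i"] by simp
  moreover have "power A i > 0" using A(1) i by (simp add: valid_network_def)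
  ultimately show False using station_neq[OF A(1) i k] by simp
qed

lemma noncrossing_family_reception_zones:
  fixes A :: "real wireless_network"
  assumes "valid_network A" and "path_loss A = 2"
  shows "noncrossing_family {1..num_stations A} (station A) (reception_zone A)"
proof
  fix i j assume "i \<in> {1..num_stations A}" "j \<in> {1..num_stations A}" "i \<noteq> j"
  then show "station A j \<notin> reception_zone A i" using reception_zone_iff[OF assms] by auto
next
  fix i k w x y z
  assume "i \<in> {1..num_stations A}" "k \<in> {1..num_stations A}" "i \<noteq> k"
    "w \<in> reception_zone A i" "x \<in> reception_zone A k"
    "y \<in> reception_zone A i" "z \<in> reception_zone A k" "w < x" "x < y"
  then show "\<not> y < z" by (rule reception_zones_noncrossing[OF assms])
next
  fix i x y
  assume "i \<in> {1..num_stations A}" "x \<in> reception_zone A i" "y \<in> reception_zone A i" "x < y"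
    "\<And>j. j \<in> {1..num_stations A} \<Longrightarrow> j \<noteq> i \<Longrightarrow> station A j \<notin> {x..y}"
  then show "{x..y} \<subseteq> reception_zone A i" by (rule reception_zone_segment[OF assms])
qed (auto simp: reception_zone_def)

theorem theorem5p1:
  fixes A :: "real wireless_network"
  assumes "valid_network A"
    and "path_loss A = 2"
  shows "(\<forall>i\<in>{1..num_stations A}. finite (cells A i)) \<and>
    (\<Sum>i\<in>{1..num_stations A}. num_cells A i) \<le> 2 * num_stations A - 1"
proof -
  note family = noncrossing_family_reception_zones[OF assms]
  have "{1..num_stations A} \<noteq> {}" using assms(1) by (simp add: valid_network_def)
  then show ?thesis
    using noncrossing_family.finite_components[OF family]
      noncrossing_family.sum_card_components_le[OF family]
    unfolding cells_def num_cells_def by simp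
qed

end
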